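(* Let $I=[a,b]\subset\mathbb{R}$ be a compact interval, let $f,g:I\to\mathbb{R}$ be Sequential Henstock integrable functions on $I$, and let $c\in\mathbb{R}$. Then: 1. If $f\ge 0$ on $I$, then $\int_I f\ge 0$. 2. $cf$ is Sequential Henstock integrable on $I$, and $\int_I cf=c\int_I f$. 3. $f+g$ is Sequential Henstock integrable on $I$, and $\int_I(f+g)=\int_I f+\int_I g$. 4. If $f(x)\le g(x)$ for all $x\in I$, then $\int_I f\le\int_I g$. 5. If $|f|$ is Sequential Henstock integrable on $I$, then $\left|\int_I f\right|\le\int_I|f|$. 6. Let $M\in\mathbb{R}$. If $|f(x)|\le M$ for all $x\in I$, then $\left|\int_a^b f\right|\le M(b-a)$.
   Context: A tagged partition $P=\{([x_{i-1},x_i],t_i)\}_{i=1}^k$ of $I=[a,b]$ consists of points $a=x_0<x_1<\dots<x_k=b$ together with tags $t_i\in[x_{i-1},x_i]$. Its Riemann sum for $f$ is $S(f,P)=\sum_{i=1}^k f(t_i)(x_i-x_{i-1})$. A gauge on $I$ is a function $\delta:I\to\mathbb{R}$ with $\delta(x)>0$ for all $x\in I$. $P$ is $\delta(x)$-fine if $x_i-x_{i-1}<\delta(t_i)$ for every $i$. $f$ is Sequential Henstock integrable on $I$ with integral $A=\int_I f=\int_a^b f\in\mathbb{R}$ if there is a sequence of gauges $\{\delta_n\}_{n=1}^\infty$ on $I$ such that, whenever $P_n$ is a $\delta_n(x)$-fine tagged partition of $I$ for each $n$, one has $S(f,P_n)\to A$ as $n\to\infty$. The value of the integral is unique. *)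

theory Defs
  imports Complex_Main
begin

(* A triple (k, x, t) stands for the finite family ([x (i - 1), x i], t i), i = 1, ..., k;
   values of x beyond k, and of t outside 1..k, are irrelevant. *)
type_synonym tagged_family = "nat \<times> (nat \<Rightarrow> real) \<times> (nat \<Rightarrow> real)"

(* For a < b the conditions force k \<ge> 1; for a = b they force k = 0. *)
fun tagged_partition :: "real \<Rightarrow> real \<Rightarrow> tagged_family \<Rightarrow> bool" where
  "tagged_partition a b (k, x, t) \<longleftrightarrow>
     x 0 = a \<and> x k = b \<and>
     (\<forall>i\<in>{1..k}. x (i - 1) < x i \<and> t i \<in> {x (i - 1)..x i})"

fun riemann_sum :: "(real \<Rightarrow> real) \<Rightarrow> tagged_family \<Rightarrow> real" where
  "riemann_sum f (k, x, t) = (\<Sum>i=1..k. f (t i) * (x i - x (i - 1)))"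

(* Unlike the set-valued gauges of HOL-Analysis, a gauge is a function that is positive
   on the interval, and fineness bounds only the length of each subinterval. *)
definition gauge_on :: "real \<Rightarrow> real \<Rightarrow> (real \<Rightarrow> real) \<Rightarrow> bool" where
  "gauge_on a b \<delta> \<longleftrightarrow> (\<forall>x\<in>{a..b}. \<delta> x > 0)"

fun delta_fine :: "(real \<Rightarrow> real) \<Rightarrow> tagged_family \<Rightarrow> bool" where
  "delta_fine \<delta> (k, x, t) \<longleftrightarrow> (\<forall>i\<in>{1..k}. x i - x (i - 1) < \<delta> (t i))"

definition has_sh_integral :: "real \<Rightarrow> real \<Rightarrow> (real \<Rightarrow> real) \<Rightarrow> real \<Rightarrow> bool" where
  "has_sh_integral a b f A \<longleftrightarrow>
     (\<exists>\<delta> :: nat \<Rightarrow> real \<Rightarrow> real.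
        (\<forall>n. gauge_on a b (\<delta> n)) \<and>
        (\<forall>P :: nat \<Rightarrow> tagged_family.
           (\<forall>n. tagged_partition a b (P n) \<and> delta_fine (\<delta> n) (P n)) \<longrightarrow>
           (\<lambda>n. riemann_sum f (P n)) \<longlonglongrightarrow> A))"

definition sh_integrable :: "real \<Rightarrow> real \<Rightarrow> (real \<Rightarrow> real) \<Rightarrow> bool" where
  "sh_integrable a b f \<longleftrightarrow> (\<exists>A. has_sh_integral a b f A)"

definition sh_integral :: "real \<Rightarrow> real \<Rightarrow> (real \<Rightarrow> real) \<Rightarrow> real" where
  "sh_integral a b f = (THE A. has_sh_integral a b f A)"

end

theory Submission
  imports Defs
begin

text \<open>
  Everything except existence of partitions is a passage to the limit. The integral of \<open>f\<close> is by
  definition the limit of the Riemann sums along every sequence of partitions that are fine for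
  the gauges of \<open>f\<close>. Given two functions with gauges \<open>\<delta>\<^sub>n\<close> and \<open>\<eta>\<^sub>n\<close>, a partition that is fine for
  \<open>min \<delta>\<^sub>n \<eta>\<^sub>n\<close> is fine for both gauges, so along one common sequence of partitions the Riemann sums of
  both functions converge to their integrals (\<open>common_partition_sequence\<close>). Since Riemann sums are
  linear and monotone in the integrand, so are their limits.

  Such a common sequence exists by Cousin's lemma (\<open>cousin\<close>): every gauge on a compact interval
  admits a fine tagged partition. Without it the defining condition could hold vacuously, and the
  integral would be neither unique nor monotone. Uniqueness and positivity are instances of
  monotonicity; the bounds on the absolute value come from comparing both \<open>f\<close>
  and \<open>- f\<close> with \<open>\<bar>f\<bar>\<close>, or with the constant \<open>M\<close>, whose Riemann sums telescope to \<open>M * (b - a)\<close>.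
\<close>

section \<open>Existence of fine tagged partitions\<close>

lemma delta_fine_mono:
  assumes "delta_fine \<delta> P" "\<And>x. \<delta> x \<le> \<eta> x"
  shows "delta_fine \<eta> P"
  using assms by (cases P) (auto intro: less_le_trans)

text \<open>Fine partitions of adjacent intervals can be concatenated; in Cousin's lemma this lets the
  property of having a fine partition pass from two abutting intervals to their union.\<close>

lemma fine_partition_append:
  assumes "tagged_partition u v P" "delta_fine \<delta> P"
    and "tagged_partition v w Q" "delta_fine \<delta> Q"
  shows "\<exists>R. tagged_partition u w R \<and> delta_fine \<delta> R"
proof -
  obtain k x t where P: "P = (k, x, t)" by (cases P)
  obtain l y s where Q: "Q = (l, y, s)" by (cases Q)
  define z where "z i = (if i \<le> k then x i else y (i - k))" for i
  define r where "r i = (if i \<le> k then t i else s (i - k))" for i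
  have ends: "x 0 = u" "x k = v" "y 0 = v" "y l = w"
    using assms P Q by auto
  have piece: "z (i - 1) < z i \<and> r i \<in> {z (i - 1)..z i} \<and> z i - z (i - 1) < \<delta> (r i)"
    if i: "i \<in> {1..k + l}" for i
  proof (cases "i \<le> k")
    case True
    then show ?thesis using assms(1,2) i by (auto simp: P z_def r_def)
  next
    case False
    then have j: "i - k \<in> {1..l}" using i by auto
    \<comment> \<open>At the seam \<open>i = k + 1\<close> the left endpoint is \<open>x k\<close> rather than \<open>y 0\<close>; both equal \<open>v\<close>.\<close>
    have "z (i - 1) = y (i - k - 1)"
    proof (cases "i = k + 1")
      case True
      then show ?thesis using ends by (simp add: z_def)
    next
      case neq: False
      then have "\<not> i - 1 \<le> k" "i - 1 - k = i - k - 1" using False by auto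
      then show ?thesis unfolding z_def by (simp only: if_False)
    qed
    moreover have "z i = y (i - k)" "r i = s (i - k)"
      using False by (simp_all add: z_def r_def)
    moreover have "y (i - k - 1) < y (i - k) \<and> s (i - k) \<in> {y (i - k - 1)..y (i - k)}"
      using assms(3) j unfolding Q tagged_partition.simps by blast
    moreover have "y (i - k) - y (i - k - 1) < \<delta> (s (i - k))"
      using assms(4) j unfolding Q delta_fine.simps by blast
    ultimately show ?thesis by simp
  qed
  have "z 0 = u" "z (k + l) = w"
    using ends by (auto simp: z_def)
  then have "tagged_partition u w (k + l, z, r) \<and> delta_fine \<delta> (k + l, z, r)"
    using piece by simp
  then show ?thesis by blast
qed

text \<open>By the Bolzano bisection principle it is enough that short intervals around each
  point \<open>p\<close> have a fine partition: an interval around \<open>p\<close> of length below \<open>\<delta> p\<close> is, as a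
  single piece with tag \<open>p\<close>, a fine partition of itself.\<close>

lemma cousin:
  assumes "a \<le> b" "gauge_on a b \<delta>"
  shows "\<exists>P. tagged_partition a b P \<and> delta_fine \<delta> P"
  using assms(1)
proof (induction rule: Bolzano)
  case (trans u v w)
  then show ?case by (blast intro: fine_partition_append)
next
  case (local p)
  have "\<exists>P. tagged_partition u v P \<and> delta_fine \<delta> P" if "u \<le> p" "p \<le> v" "v - u < \<delta> p" for u v
  proof (cases "u = v")
    case True
    \<comment> \<open>A degenerate interval admits only the empty family of pieces.\<close>
    then have "tagged_partition u v (0, \<lambda>_. u, \<lambda>_. p) \<and> delta_fine \<delta> (0, \<lambda>_. u, \<lambda>_. p)"
      by simp
    then show ?thesis by blast
  next
    case False
    then have "tagged_partition u v (1, \<lambda>i. if i = 0 then u else v, \<lambda>_. p) \<and>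
        delta_fine \<delta> (1, \<lambda>i. if i = 0 then u else v, \<lambda>_. p)"
      using that by simp
    then show ?thesis by blast
  qed
  moreover have "\<delta> p > 0"
    using local assms(2) by (simp add: gauge_on_def)
  ultimately show ?case by blast
qed

section \<open>Riemann sums\<close>

lemma riemann_sum_cmult: "riemann_sum (\<lambda>x. c * f x) P = c * riemann_sum f P"
  by (cases P) (simp add: sum_distrib_left mult.assoc)

lemma riemann_sum_add: "riemann_sum (\<lambda>x. f x + g x) P = riemann_sum f P + riemann_sum g P"
  by (cases P) (simp add: sum.distrib distrib_right)

lemma riemann_sum_const:
  assumes "tagged_partition a b P"
  shows "riemann_sum (\<lambda>_. c) P = c * (b - a)"
proof -
  obtain k x t where P: "P = (k, x, t)" by (cases P)
  have "(\<Sum>i=1..k. x i - x (i - 1)) = x k - x 0"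
    using sum_telescope''[of 0 k x] by simp
  then show ?thesis
    using assms by (simp add: P flip: sum_distrib_left)
qed

text \<open>Inequalities between integrands are only given on the interval, so the tags have to be
  known to lie in it.\<close>

lemma tags_in_interval:
  assumes "tagged_partition a b (k, x, t)" "i \<in> {1..k}"
  shows "t i \<in> {a..b}"
proof -
  have steps: "x j \<le> x (Suc j)" if "j < k" for j
  proof -
    have "Suc j \<in> {1..k}" using that by simp
    then have "x (Suc j - 1) < x (Suc j)"
      using assms(1) unfolding tagged_partition.simps by blast
    then show ?thesis by simp
  qed
  have mono: "x m \<le> x n" if "m \<le> n" "n \<le> k" for m n
    using that
  proof (induction rule: dec_induct)
    case (step j)
    then show ?case using steps[of j] by simp
  qed simp
  have "x 0 \<le> x (i - 1)" "x i \<le> x k"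
    using assms(2) by (auto intro!: mono)
  moreover have "t i \<in> {x (i - 1)..x i}"
    using assms unfolding tagged_partition.simps by blast
  ultimately show ?thesis
    using assms(1) by simp
qed

lemma riemann_sum_mono:
  assumes P: "tagged_partition a b P" and le: "\<And>x. x \<in> {a..b} \<Longrightarrow> f x \<le> g x"
  shows "riemann_sum f P \<le> riemann_sum g P"
proof -
  obtain k x t where eq: "P = (k, x, t)" by (cases P)
  have "f (t i) * (x i - x (i - 1)) \<le> g (t i) * (x i - x (i - 1))" if i: "i \<in> {1..k}" for i
  proof (rule mult_right_mono)
    show "f (t i) \<le> g (t i)"
      using tags_in_interval[OF P[unfolded eq] i] by (rule le)
    show "0 \<le> x i - x (i - 1)"
      using P i unfolding eq tagged_partition.simps by (simp add: less_imp_le)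
  qed
  then show ?thesis
    unfolding eq riemann_sum.simps by (rule sum_mono)
qed

section \<open>Linearity and monotonicity of the integral\<close>

text \<open>The relational forms below carry no uniqueness obligation; the passage
  to \<^const>\<open>sh_integral\<close> is made once uniqueness is known.\<close>

lemma has_sh_integral_const: "has_sh_integral a b (\<lambda>_. c) (c * (b - a))"
proof -
  have "(\<lambda>n. riemann_sum (\<lambda>_. c) (P n)) \<longlonglongrightarrow> c * (b - a)" if "\<And>n. tagged_partition a b (P n)" for P
    unfolding riemann_sum_const[OF that] by (rule tendsto_const)
  then show ?thesis
    unfolding has_sh_integral_def by (intro exI[of _ "\<lambda>_ _. 1"]) (simp add: gauge_on_def)
qed

lemma has_sh_integral_cmult:
  assumes "has_sh_integral a b f A"
  shows "has_sh_integral a b (\<lambda>x. c * f x) (c * A)"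
proof -
  obtain \<delta> where "\<And>n. gauge_on a b (\<delta> n)"
    "\<And>P. (\<And>n. tagged_partition a b (P n) \<and> delta_fine (\<delta> n) (P n)) \<Longrightarrow>
      (\<lambda>n. riemann_sum f (P n)) \<longlonglongrightarrow> A"
    using assms unfolding has_sh_integral_def by blast
  then show ?thesis
    unfolding has_sh_integral_def riemann_sum_cmult
    by (intro exI[of _ \<delta>]) (simp add: tendsto_mult_left)
qed

text \<open>The pointwise minimum of the two gauges serves both functions; this is what makes it
  possible to treat them along the same partitions.\<close>

lemma common_gauges:
  assumes "has_sh_integral a b f A" "has_sh_integral a b g B"
  obtains \<delta> where "\<And>n. gauge_on a b (\<delta> n)"
    and "\<And>P. (\<And>n. tagged_partition a b (P n) \<and> delta_fine (\<delta> n) (P n)) \<Longrightarrow>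
          (\<lambda>n. riemann_sum f (P n)) \<longlonglongrightarrow> A \<and> (\<lambda>n. riemann_sum g (P n)) \<longlonglongrightarrow> B"
proof -
  obtain \<delta> where \<delta>: "\<And>n. gauge_on a b (\<delta> n)"
    "\<And>P. (\<And>n. tagged_partition a b (P n) \<and> delta_fine (\<delta> n) (P n)) \<Longrightarrow>
      (\<lambda>n. riemann_sum f (P n)) \<longlonglongrightarrow> A"
    using assms(1) unfolding has_sh_integral_def by blast
  obtain \<eta> where \<eta>: "\<And>n. gauge_on a b (\<eta> n)"
    "\<And>P. (\<And>n. tagged_partition a b (P n) \<and> delta_fine (\<eta> n) (P n)) \<Longrightarrow>
      (\<lambda>n. riemann_sum g (P n)) \<longlonglongrightarrow> B"
    using assms(2) unfolding has_sh_integral_def by blast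
  define \<mu> where "\<mu> n x = min (\<delta> n x) (\<eta> n x)" for n x
  show thesis
  proof
    show "gauge_on a b (\<mu> n)" for n
      using \<delta>(1)[of n] \<eta>(1)[of n] by (simp add: gauge_on_def \<mu>_def)
    fix P assume P: "\<And>n. tagged_partition a b (P n) \<and> delta_fine (\<mu> n) (P n)"
    have "delta_fine (\<delta> n) (P n)" "delta_fine (\<eta> n) (P n)" for n
      using P[of n] by (auto elim: delta_fine_mono simp: \<mu>_def)
    then show "(\<lambda>n. riemann_sum f (P n)) \<longlonglongrightarrow> A \<and> (\<lambda>n. riemann_sum g (P n)) \<longlonglongrightarrow> B"
      using P \<delta>(2) \<eta>(2) by blast
  qed
qed

lemma has_sh_integral_add:
  assumes "has_sh_integral a b f A" "has_sh_integral a b g B"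
  shows "has_sh_integral a b (\<lambda>x. f x + g x) (A + B)"
proof -
  obtain \<delta> where "\<And>n. gauge_on a b (\<delta> n)"
    "\<And>P. (\<And>n. tagged_partition a b (P n) \<and> delta_fine (\<delta> n) (P n)) \<Longrightarrow>
      (\<lambda>n. riemann_sum f (P n)) \<longlonglongrightarrow> A \<and> (\<lambda>n. riemann_sum g (P n)) \<longlonglongrightarrow> B"
    using common_gauges[OF assms] by blast
  then show ?thesis
    unfolding has_sh_integral_def riemann_sum_add
    by (intro exI[of _ \<delta>]) (simp add: tendsto_add)
qed

text \<open>Cousin's lemma enters here: it supplies partitions fine for the common gauges, so that the
  two integrals become limits along an actual sequence and can be compared.\<close>

lemma common_partition_sequence:
  assumes "a \<le> b" "has_sh_integral a b f A" "has_sh_integral a b g B"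
  obtains P where "\<And>n. tagged_partition a b (P n)"
    and "(\<lambda>n. riemann_sum f (P n)) \<longlonglongrightarrow> A" and "(\<lambda>n. riemann_sum g (P n)) \<longlonglongrightarrow> B"
proof -
  obtain \<delta> where \<delta>: "\<And>n. gauge_on a b (\<delta> n)"
    "\<And>P. (\<And>n. tagged_partition a b (P n) \<and> delta_fine (\<delta> n) (P n)) \<Longrightarrow>
      (\<lambda>n. riemann_sum f (P n)) \<longlonglongrightarrow> A \<and> (\<lambda>n. riemann_sum g (P n)) \<longlonglongrightarrow> B"
    using common_gauges[OF assms(2,3)] by blast
  have "\<forall>n. \<exists>P. tagged_partition a b P \<and> delta_fine (\<delta> n) P"
    using cousin[OF assms(1) \<delta>(1)] by blast
  then obtain P where "\<And>n. tagged_partition a b (P n) \<and> delta_fine (\<delta> n) (P n)"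
    by metis
  then show thesis
    using \<delta>(2) that by blast
qed

lemma has_sh_integral_mono:
  assumes "a \<le> b" "has_sh_integral a b f A" "has_sh_integral a b g B"
    and "\<And>x. x \<in> {a..b} \<Longrightarrow> f x \<le> g x"
  shows "A \<le> B"
proof -
  obtain P where P: "\<And>n. tagged_partition a b (P n)"
    and lim: "(\<lambda>n. riemann_sum f (P n)) \<longlonglongrightarrow> A" "(\<lambda>n. riemann_sum g (P n)) \<longlonglongrightarrow> B"
    using common_partition_sequence[OF assms(1-3)] by blast
  have "riemann_sum f (P n) \<le> riemann_sum g (P n)" for n
    using P assms(4) by (rule riemann_sum_mono)
  then show ?thesis
    using lim by (blast intro: LIMSEQ_le)
qed

lemma sh_integral_eq:
  assumes "a \<le> b" "has_sh_integral a b f A"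
  shows "sh_integral a b f = A"
  unfolding sh_integral_def
proof (rule the_equality)
  show "has_sh_integral a b f A" by fact
  show "B = A" if "has_sh_integral a b f B" for B
    using has_sh_integral_mono[OF assms(1) that assms(2)]
      has_sh_integral_mono[OF assms that] by force
qed

text \<open>Both estimates of the absolute value of an integral are instances of this one, with \<open>g\<close>
  equal to \<open>\<bar>f\<bar>\<close> or to a constant bound.\<close>

lemma has_sh_integral_abs_bound:
  assumes "a \<le> b" "has_sh_integral a b f A" "has_sh_integral a b g B"
    and le: "\<And>x. x \<in> {a..b} \<Longrightarrow> \<bar>f x\<bar> \<le> g x"
  shows "\<bar>A\<bar> \<le> B"
proof -
  have "A \<le> B"
    using assms(1-3) by (rule has_sh_integral_mono) (use le in force)
  moreover have "-1 * A \<le> B"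
    using assms(1) has_sh_integral_cmult[OF assms(2)] assms(3)
    by (rule has_sh_integral_mono) (use le in force)
  ultimately show ?thesis by simp
qed

theorem theorem5:
  fixes a b c :: real and f g :: "real \<Rightarrow> real"
  assumes "a \<le> b"
    and "sh_integrable a b f"
    and "sh_integrable a b g"
  shows "((\<forall>x\<in>{a..b}. f x \<ge> 0) \<longrightarrow> sh_integral a b f \<ge> 0) \<and>
    (sh_integrable a b (\<lambda>x. c * f x) \<and>
      sh_integral a b (\<lambda>x. c * f x) = c * sh_integral a b f) \<and>
    (sh_integrable a b (\<lambda>x. f x + g x) \<and>
      sh_integral a b (\<lambda>x. f x + g x) = sh_integral a b f + sh_integral a b g) \<and>
    ((\<forall>x\<in>{a..b}. f x \<le> g x) \<longrightarrow> sh_integral a b f \<le> sh_integral a b g) \<and>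
    (sh_integrable a b (\<lambda>x. \<bar>f x\<bar>) \<longrightarrow>
      \<bar>sh_integral a b f\<bar> \<le> sh_integral a b (\<lambda>x. \<bar>f x\<bar>)) \<and>
    (\<forall>M::real. (\<forall>x\<in>{a..b}. \<bar>f x\<bar> \<le> M) \<longrightarrow>
      \<bar>sh_integral a b f\<bar> \<le> M * (b - a))"
proof -
  obtain A B where A: "has_sh_integral a b f A" and B: "has_sh_integral a b g B"
    using assms(2,3) unfolding sh_integrable_def by blast
  note eq = sh_integral_eq[OF assms(1)]
  note mult = has_sh_integral_cmult[OF A, of c]
  note add = has_sh_integral_add[OF A B]
  have nonneg: "0 \<le> A" if "\<forall>x\<in>{a..b}. f x \<ge> 0"
    using has_sh_integral_mono[OF assms(1) has_sh_integral_const[of a b 0] A] that by simp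
  have le: "A \<le> B" if "\<forall>x\<in>{a..b}. f x \<le> g x"
    using has_sh_integral_mono[OF assms(1) A B] that by blast
  have abs_le: "\<bar>A\<bar> \<le> sh_integral a b (\<lambda>x. \<bar>f x\<bar>)" if integrable: "sh_integrable a b (\<lambda>x. \<bar>f x\<bar>)"
  proof -
    obtain C where C: "has_sh_integral a b (\<lambda>x. \<bar>f x\<bar>) C"
      using integrable unfolding sh_integrable_def by blast
    show ?thesis
      using has_sh_integral_abs_bound[OF assms(1) A C] eq[OF C] by simp
  qed
  have bound: "\<bar>A\<bar> \<le> M * (b - a)" if "\<forall>x\<in>{a..b}. \<bar>f x\<bar> \<le> M" for M
    using has_sh_integral_abs_bound[OF assms(1) A has_sh_integral_const] that by blast
  show ?thesis
    unfolding eq[OF A] eq[OF B] eq[OF mult] eq[OF add]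
    using nonneg le abs_le bound mult add unfolding sh_integrable_def by blast
qed

end
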